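(* Let $0<\alpha\le 1\le\beta$ and let $T\in\mathcal{M}_n$ be $(\alpha,\beta)$-normal. Then $$\|T\|^2\le\frac{1}{\alpha}\|T^2\|\quad\text{and}\quad\|T\|^2\le\beta\|T^2\|.$$ Indeed, $$\|T\|^2\le\min\left\{\frac1\alpha,\beta\right\}\|T^2\|.$$
   Context: $\mathcal{M}_n$ is the algebra of $n\times n$ complex matrices; $\|\cdot\|$ is the usual operator (spectral) norm; $|T|=(T^*T)^{1/2}$ and $|T^*|=(TT^* )^{1/2}$. For Hermitian matrices, $A\le B$ means $B-A$ is positive semidefinite. $T$ is $(\alpha,\beta)$-normal if $\alpha^2|T|^2\le|T^*|^2\le\beta^2|T|^2$. *)

theory Defs
  imports "HOL-Analysis.Analysis"
begin

text \<open>
  An \<open>n \<times> n\<close> complex matrix is a value of type \<open>complex ^ 'n ^ 'n\<close>. On this type the class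
  operations \<open>*\<close>, \<open>^\<close> and \<open>\<le>\<close> act entrywise and \<open>norm\<close> is the Frobenius norm; none of them is
  the operation intended here, so products are written with \<open>**\<close> and the order and the norm are
  the constants below.
\<close>

definition conj_transpose :: "complex ^ 'n ^ 'm \<Rightarrow> complex ^ 'm ^ 'n" where
  "conj_transpose A = (\<chi> i j. cnj (A $ j $ i))"

definition hermitian :: "complex ^ 'n ^ 'n \<Rightarrow> bool" where
  "hermitian A \<longleftrightarrow> conj_transpose A = A"

text \<open>The sum is \<open>x\<^sup>* A x\<close>, which is real for Hermitian \<open>A\<close>.\<close>

definition pos_semidef :: "complex ^ 'n ^ 'n \<Rightarrow> bool" where
  "pos_semidef A \<longleftrightarrow> hermitian A \<and> (\<forall>x. 0 \<le> Re (\<Sum>i\<in>UNIV. cnj (x $ i) * (A *v x) $ i))"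

definition loewner_le :: "complex ^ 'n ^ 'n \<Rightarrow> complex ^ 'n ^ 'n \<Rightarrow> bool" where
  "loewner_le A B \<longleftrightarrow> hermitian A \<and> hermitian B \<and> pos_semidef (B - A)"

text \<open>A positive semidefinite matrix has exactly one positive semidefinite square root; on other
  arguments the value is unspecified.\<close>

definition psd_sqrt :: "complex ^ 'n ^ 'n \<Rightarrow> complex ^ 'n ^ 'n" where
  "psd_sqrt A = (THE S. pos_semidef S \<and> S ** S = A)"

definition mat_abs :: "complex ^ 'n ^ 'n \<Rightarrow> complex ^ 'n ^ 'n" where
  "mat_abs T = psd_sqrt (conj_transpose T ** T)"

definition alpha_beta_normal :: "real \<Rightarrow> real \<Rightarrow> complex ^ 'n ^ 'n \<Rightarrow> bool" where
  "alpha_beta_normal \<alpha> \<beta> T \<longleftrightarrow>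
     loewner_le (\<alpha>\<^sup>2 *\<^sub>R (mat_abs T ** mat_abs T))
       (mat_abs (conj_transpose T) ** mat_abs (conj_transpose T)) \<and>
     loewner_le (mat_abs (conj_transpose T) ** mat_abs (conj_transpose T))
       (\<beta>\<^sup>2 *\<^sub>R (mat_abs T ** mat_abs T))"

text \<open>The norm on \<open>complex ^ 'n\<close> is the Euclidean one, so this is the spectral norm.\<close>

definition op_norm :: "complex ^ 'n ^ 'n \<Rightarrow> real" where
  "op_norm A = onorm (\<lambda>x. A *v x)"

end

theory Submission
  imports Defs
begin

text \<open>
  Since \<open>|T|\<^sup>2 = T\<^sup>* T\<close> and \<open>|T\<^sup>*|\<^sup>2 = T T\<^sup>*\<close>, normality says
  \<open>\<alpha> \<parallel>T x\<parallel> \<le> \<parallel>T\<^sup>* x\<parallel> \<le> \<beta> \<parallel>T x\<parallel>\<close>. The upper bound at \<open>T x\<close> gives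
  \<open>\<parallel>T\<parallel>\<^sup>2 = \<parallel>T\<^sup>* T\<parallel> \<le> \<beta> \<parallel>T\<^sup>2\<parallel>\<close>, the lower bound at \<open>T\<^sup>* x\<close> gives
  \<open>\<alpha> \<parallel>T\<parallel>\<^sup>2 = \<alpha> \<parallel>T T\<^sup>*\<parallel> \<le> \<parallel>(T\<^sup>*)\<^sup>2\<parallel> = \<parallel>T\<^sup>2\<parallel>\<close>.

  The positive square root of \<open>T\<^sup>* T\<close> is obtained without the spectral theorem: if \<open>W\<close> maximizes
  \<open>Re (tr (W\<^sup>* T))\<close> over the compact unitary group, then comparing \<open>W\<close> with its products with complex
  reflections shows that \<open>W\<^sup>* T\<close> is positive semidefinite, and its square is \<open>T\<^sup>* T\<close>.
\<close>

section \<open>Adjoints and real inner products\<close>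

text \<open>Throughout, \<open>\<bullet>\<close> is the real inner product, that is, \<open>Re (x\<^sup>* y)\<close> on vectors and
  \<open>Re (tr (A\<^sup>* B))\<close> on matrices.\<close>

lemma conj_transpose_conj_transpose [simp]: "conj_transpose (conj_transpose A) = A"
  by (simp add: conj_transpose_def vec_eq_iff)

lemma conj_transpose_mult: "conj_transpose (A ** B) = conj_transpose B ** conj_transpose A"
  by (simp add: conj_transpose_def matrix_matrix_mult_def vec_eq_iff mult.commute)

lemma conj_transpose_diff: "conj_transpose (A - B) = conj_transpose A - conj_transpose B"
  by (simp add: conj_transpose_def vec_eq_iff)

lemma matrix_mult_diff_left: "(A - B) ** C = A ** C - B ** C" for A :: "'a::ring_1 ^ 'n ^ 'm"
  by (simp add: matrix_matrix_mult_def vec_eq_iff left_diff_distrib sum_subtractf)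

lemma matrix_mult_diff_right: "A ** (B - C) = A ** B - A ** C" for A :: "'a::ring_1 ^ 'n ^ 'm"
  by (simp add: matrix_matrix_mult_def vec_eq_iff right_diff_distrib sum_subtractf)

lemma conj_transpose_mat_1 [simp]: "conj_transpose (mat 1) = mat 1"
  by (simp add: conj_transpose_def mat_def vec_eq_iff)

lemma inner_complex_eq_Re: "(a::complex) \<bullet> b = Re (cnj a * b)"
  by (simp add: inner_complex_def)

lemma inner_cvec_eq_Re: "(x :: complex ^ 'n) \<bullet> y = Re (\<Sum>i\<in>UNIV. cnj (x $ i) * y $ i)"
  by (simp add: inner_vec_def inner_complex_eq_Re)

lemma inner_matrix_vector:
  fixes A :: "complex ^ 'n ^ 'm"
  shows "x \<bullet> (A *v y) = (conj_transpose A *v x) \<bullet> y"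
proof -
  have "(\<Sum>i\<in>UNIV. cnj (x $ i) * (A *v y) $ i)
      = (\<Sum>i\<in>UNIV. \<Sum>j\<in>UNIV. cnj (x $ i) * (A $ i $ j * y $ j))"
    by (simp add: matrix_vector_mult_def sum_distrib_left)
  also have "\<dots> = (\<Sum>j\<in>UNIV. \<Sum>i\<in>UNIV. cnj (x $ i) * (A $ i $ j * y $ j))"
    by (rule sum.swap)
  also have "\<dots> = (\<Sum>j\<in>UNIV. cnj ((conj_transpose A *v x) $ j) * y $ j)"
    by (simp add: matrix_vector_mult_def conj_transpose_def sum_distrib_left sum_distrib_right ac_simps)
  finally show ?thesis
    by (simp add: inner_cvec_eq_Re)
qed

text \<open>Reduces pairings of matrices to pairings of columns, so that facts about vectors
  transfer through \<open>column_matrix_mult\<close>.\<close>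

lemma inner_matrix_columns:
  fixes A B :: "'a::real_inner ^ 'n ^ 'm"
  shows "A \<bullet> B = (\<Sum>j\<in>UNIV. column j A \<bullet> column j B)"
proof -
  have "A \<bullet> B = (\<Sum>i\<in>UNIV. \<Sum>j\<in>UNIV. A $ i $ j \<bullet> B $ i $ j)"
    by (simp add: inner_vec_def)
  also have "\<dots> = (\<Sum>j\<in>UNIV. \<Sum>i\<in>UNIV. A $ i $ j \<bullet> B $ i $ j)"
    by (rule sum.swap)
  finally show ?thesis
    by (simp add: inner_vec_def column_def)
qed

lemma column_matrix_mult: "column j (A ** B) = A *v column j B"
  by (simp add: column_def matrix_matrix_mult_def matrix_vector_mult_def vec_eq_iff)

lemma inner_matrix_mult_left:
  fixes A :: "complex ^ 'k ^ 'm"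
  shows "A \<bullet> (B ** C) = (conj_transpose B ** A) \<bullet> C"
  by (simp add: inner_matrix_columns column_matrix_mult inner_matrix_vector)

lemma inner_conj_transpose: "conj_transpose A \<bullet> conj_transpose B = A \<bullet> B"
  unfolding inner_matrix_columns[of A B]
  by (simp add: inner_vec_def conj_transpose_def column_def inner_complex_def)

lemma pos_semidef_iff_inner:
  "pos_semidef A \<longleftrightarrow> conj_transpose A = A \<and> (\<forall>x. 0 \<le> x \<bullet> (A *v x))"
  by (simp only: pos_semidef_def hermitian_def inner_cvec_eq_Re)

text \<open>With \<open>y = S *v x\<close>, the form at \<open>x - t y\<close> is
  \<open>-2 t |y|^2 + t^2 k\<close>. For small positive \<open>t\<close> the linear term would win
  and make it negative, unless \<open>y = 0\<close>.\<close>

lemma pos_semidef_kernel: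
  assumes "pos_semidef S" and "x \<bullet> (S *v x) = 0"
  shows "S *v x = 0"
proof -
  define y where "y = S *v x"
  define k where "k = y \<bullet> (S *v y)"
  have k: "0 \<le> k" and herm: "conj_transpose S = S"
    using assms(1) by (auto simp: pos_semidef_iff_inner k_def)
  have xy: "x \<bullet> (S *v y) = y \<bullet> y"
    using inner_matrix_vector[of x S y] by (simp add: herm y_def)
  have ineq: "0 \<le> - 2 * t * (y \<bullet> y) + t\<^sup>2 * k" for t
  proof -
    have "0 \<le> (x - t *\<^sub>R y) \<bullet> (S *v (x - t *\<^sub>R y))"
      using assms(1) by (simp add: pos_semidef_iff_inner)
    also have "\<dots> = - 2 * t * (y \<bullet> y) + t\<^sup>2 * k"
      using assms(2) xy
      by (simp add: matrix_vector_mult_diff_distrib linear_scale[OF matrix_vector_mul_linear] inner_diff_left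
          inner_diff_right y_def[symmetric] k_def[symmetric] power2_eq_square algebra_simps)
    finally show ?thesis .
  qed
  have "y \<bullet> y = 0"
  proof (rule ccontr)
    assume "y \<bullet> y \<noteq> 0"
    then have pos: "0 < y \<bullet> y" by simp
    \<comment> \<open>Any positive \<open>t\<close> with \<open>t * k < 2 * (y \<bullet> y)\<close>
      will do; the \<open>+ 1\<close> covers \<open>k = 0\<close>.\<close>
    define t where "t = (y \<bullet> y) / (k + 1)"
    have t: "0 < t" and "t * (k + 1) = y \<bullet> y"
      using pos k by (auto simp: t_def)
    then have "t * k + t = y \<bullet> y"
      by (simp add: distrib_left)
    then have "t * k < 2 * (y \<bullet> y)"
      using pos t by linarith
    then have "t * (t * k) < t * (2 * (y \<bullet> y))"
      using t by (rule mult_strict_left_mono)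
    then show False
      using ineq[of t] by (simp add: power2_eq_square algebra_simps)
  qed
  then show ?thesis by (simp add: y_def)
qed

section \<open>The positive square root\<close>

text \<open>For \<open>D = S - R\<close> the squares cancel in \<open>S D + D R\<close>. Pairing
  this with \<open>D\<close> gives two nonnegative terms of sum zero, so
  \<open>S D = R D = 0\<close>. Hence \<open>D D = 0\<close>, and \<open>D\<close> is
  Hermitian.\<close>

lemma pos_semidef_sqrt_unique:
  fixes S R :: "complex ^ 'n ^ 'n"
  assumes S: "pos_semidef S" and R: "pos_semidef R" and eq: "S ** S = R ** R"
  shows "S = R"
proof -
  define D where "D = S - R"
  have hS: "conj_transpose S = S" and hR: "conj_transpose R = R"
    using S R by (auto simp: pos_semidef_iff_inner)
  then have hD: "conj_transpose D = D"
    by (simp add: D_def conj_transpose_diff)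
  have "S ** D + D ** R = 0"
    using eq by (simp add: D_def matrix_mult_diff_left matrix_mult_diff_right)
  then have "D \<bullet> (S ** D) + D \<bullet> (D ** R) = 0"
    by (metis inner_add_right inner_zero_right)
  moreover have "D \<bullet> (D ** R) = D \<bullet> (R ** D)"
    using inner_conj_transpose[of D "D ** R"] by (simp add: conj_transpose_mult hD hR)
  ultimately have sum0: "D \<bullet> (S ** D) + D \<bullet> (R ** D) = 0"
    by simp
  have expand: "D \<bullet> (A ** D) = (\<Sum>j\<in>UNIV. column j D \<bullet> (A *v column j D))" for A
    by (simp add: inner_matrix_columns column_matrix_mult)
  have nonneg: "0 \<le> column j D \<bullet> (A *v column j D)" if "pos_semidef A" for A j
    using that by (simp add: pos_semidef_iff_inner)
  \<comment> \<open>The pairing is a sum of values of the form of \<open>A\<close> at the columns of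
    \<open>D\<close>, so each value vanishes and each column lies in the kernel.\<close>
  have kill: "A ** D = 0" if A: "pos_semidef A" and z: "D \<bullet> (A ** D) = 0" for A
  proof -
    have "\<forall>j\<in>UNIV. column j D \<bullet> (A *v column j D) = 0"
      using z nonneg[OF A] by (subst (asm) expand, subst (asm) sum_nonneg_eq_0_iff) auto
    then have "column j (A ** D) = 0" for j
      by (simp add: column_matrix_mult pos_semidef_kernel[OF A])
    then show ?thesis
      by (simp add: column_def vec_eq_iff)
  qed
  have "0 \<le> D \<bullet> (S ** D)" "0 \<le> D \<bullet> (R ** D)"
    unfolding expand by (auto intro!: sum_nonneg nonneg S R)
  with sum0 have "D \<bullet> (S ** D) = 0" "D \<bullet> (R ** D) = 0"
    by auto
  then have "S ** D = 0" "R ** D = 0"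
    using kill S R by auto
  then have "D ** D = 0"
    by (simp add: D_def matrix_mult_diff_left)
  then have "D \<bullet> D = 0"
    using inner_matrix_mult_left[of D D "mat 1"] inner_matrix_mult_left[of "mat 1" D D]
    by (simp add: hD inner_commute)
  then show ?thesis by (simp add: D_def)
qed

text \<open>The imaginary part of \<open>x^* P y\<close> vanishes for \<open>x = y\<close>, so by
  polarization it is skew. Multiplying both vectors by \<open>\<i>\<close> converts this into
  symmetry of the real part, which is self-adjointness.\<close>

lemma hermitian_if_Im_quadratic_zero:
  assumes "\<And>x. Im (\<Sum>i\<in>UNIV. cnj (x $ i) * (P *v x) $ i) = 0"
  shows "hermitian P"
proof -
  have scale: "(\<i> *s x) \<bullet> y = Im (\<Sum>i\<in>UNIV. cnj (x $ i) * y $ i)" for x y :: "complex ^ 'a"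
    by (simp add: inner_cvec_eq_Re)
  have zero: "(\<i> *s x) \<bullet> (P *v x) = 0" for x
    using assms by (simp only: scale)
  have skew: "(\<i> *s x) \<bullet> (P *v y) = - ((\<i> *s y) \<bullet> (P *v x))" for x y
    using zero[of "x + y"] zero[of x] zero[of y]
    by (simp add: vector_add_ldistrib matrix_vector_right_distrib inner_add_left inner_add_right)
  have symm: "x \<bullet> (P *v y) = y \<bullet> (P *v x)" for x y
  proof -
    have "x \<bullet> (P *v y) = (\<i> *s x) \<bullet> (P *v (\<i> *s y))"
      by (simp add: vector_scalar_commute scale inner_cvec_eq_Re sum_distrib_left)
    also have "\<dots> = - ((\<i> *s (\<i> *s y)) \<bullet> (P *v x))"
      by (rule skew)
    also have "\<i> *s (\<i> *s y) = - y"
      by (simp add: vec_eq_iff)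
    finally show ?thesis by simp
  qed
  have "(conj_transpose P *v x - P *v x) \<bullet> y = 0" for x y
    by (simp only: inner_diff_left inner_matrix_vector[symmetric] symm[of x y]
        inner_commute[of "P *v x"] diff_self)
  then have "conj_transpose P *v x - P *v x = 0" for x
    by (meson inner_eq_zero_iff)
  then have "conj_transpose P *v x = P *v x" for x
    by (simp only: right_minus_eq)
  then show ?thesis
    by (simp add: hermitian_def matrix_eq)
qed

section \<open>Existence of the root through polar decomposition\<close>

lemma unitary_maximizer_exists:
  fixes T :: "complex ^ 'n ^ 'n"
  obtains W where "conj_transpose W ** W = mat 1"
    and "\<And>V. conj_transpose V ** V = mat 1 \<Longrightarrow> T \<bullet> V \<le> T \<bullet> W"
proof -
  let ?U = "{W :: complex ^ 'n ^ 'n. conj_transpose W ** W = mat 1}"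
  have "?U = {W. \<forall>i j. (\<Sum>k\<in>UNIV. cnj (W $ k $ i) * W $ k $ j) = mat 1 $ i $ j}"
    by (simp add: conj_transpose_def matrix_matrix_mult_def vec_eq_iff)
  moreover have "closed \<dots>"
    by (intro closed_Collect_all closed_Collect_eq continuous_intros)
  ultimately have "closed ?U" by (simp only:)
  \<comment> \<open>In the Frobenius norm all unitary matrices lie on one sphere, which gives
    boundedness.\<close>
  have norm_U: "norm W = norm (mat 1 :: complex ^ 'n ^ 'n)" if "W \<in> ?U" for W
    using that inner_matrix_mult_left[of W W "mat 1"] inner_matrix_mult_left[of "mat 1" W W]
    by (simp add: norm_eq_sqrt_inner)
  have "bounded ?U"
    by (rule boundedI, rule eq_refl, rule norm_U)
  with \<open>closed ?U\<close> have "compact ?U"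
    by (simp add: compact_eq_bounded_closed)
  moreover have "mat 1 \<in> ?U"
    by simp
  then have "?U \<noteq> {}"
    by (metis empty_iff)
  moreover have "continuous_on ?U (\<lambda>W. T \<bullet> W)"
    by (intro continuous_intros)
  ultimately obtain W where "W \<in> ?U" and "\<forall>V\<in>?U. T \<bullet> V \<le> T \<bullet> W"
    by (meson continuous_attains_sup)
  with that show ?thesis by blast
qed

definition rank_one :: "complex \<Rightarrow> complex ^ 'n \<Rightarrow> complex ^ 'n ^ 'n" where
  "rank_one z x = (\<chi> i j. z * x $ i * cnj (x $ j))"

lemma conj_transpose_rank_one: "conj_transpose (rank_one z x) = rank_one (cnj z) x"
  by (simp add: rank_one_def conj_transpose_def vec_eq_iff ac_simps)

lemma rank_one_mult:
  "rank_one z x ** rank_one w x = rank_one (z * w * of_real (x \<bullet> x)) x"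
proof -
  have "complex_of_real (x \<bullet> x) = (\<Sum>k\<in>UNIV. cnj (x $ k) * x $ k)"
    by (simp add: inner_vec_def inner_complex_def complex_eq_iff power2_eq_square)
  then show ?thesis
    by (simp add: rank_one_def matrix_matrix_mult_def vec_eq_iff sum_distrib_left
        sum_distrib_right ac_simps)
qed

text \<open>Converts the change of the trace functional under a rank-one perturbation into a value
  of the quadratic form of \<open>P\<close>.\<close>

lemma inner_rank_one:
  "P \<bullet> rank_one z x = Re (cnj z * (\<Sum>i\<in>UNIV. cnj (x $ i) * (P *v x) $ i))"
proof -
  have "P \<bullet> rank_one z x = (\<Sum>i\<in>UNIV. \<Sum>j\<in>UNIV. rank_one z x $ i $ j \<bullet> P $ i $ j)"
    by (simp add: inner_vec_def inner_commute)
  also have "\<dots> = Re (\<Sum>i\<in>UNIV. \<Sum>j\<in>UNIV. cnj (rank_one z x $ i $ j) * P $ i $ j)"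
    by (simp add: inner_complex_eq_Re)
  also have "(\<Sum>i\<in>UNIV. \<Sum>j\<in>UNIV. cnj (rank_one z x $ i $ j) * P $ i $ j)
      = cnj z * (\<Sum>i\<in>UNIV. cnj (x $ i) * (P *v x) $ i)"
    by (simp add: rank_one_def matrix_vector_mult_def sum_distrib_left ac_simps)
  finally show ?thesis .
qed

text \<open>\<open>H\<close> multiplies \<open>x\<close> by the phase \<open>w\<close> and fixes the
  orthogonal complement of \<open>x\<close>.\<close>

lemma complex_reflection_unitary:
  fixes x :: "complex ^ 'n"
  assumes "x \<noteq> 0" and "cmod w = 1"
  defines "H \<equiv> mat 1 - rank_one ((1 - w) / of_real (x \<bullet> x)) x"
  shows "conj_transpose H ** H = mat 1"
proof -
  define n where "n = complex_of_real (x \<bullet> x)"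
  define z where "z = (1 - w) / n"
  have n: "n \<noteq> 0" "cnj n = n"
    using assms(1) by (auto simp: n_def)
  have w: "cnj w * w = 1"
    using assms(2) by (simp add: mult.commute complex_norm_square[symmetric])
  \<comment> \<open>This is \<open>|1 - w|^2 = 2 - w - cnj w\<close> for \<open>|w| = 1\<close>; it
    makes the quadratic term cancel the two linear ones.\<close>
  have "cnj z * z * n = cnj z + z"
    using n w by (simp add: z_def field_simps)
  have "rank_one (cnj z) x ** rank_one z x = rank_one (cnj z + z) x"
    by (simp add: rank_one_mult n_def[symmetric] \<open>cnj z * z * n = cnj z + z\<close>)
  also have "\<dots> = rank_one (cnj z) x + rank_one z x"
    by (simp add: rank_one_def vec_eq_iff algebra_simps)
  finally have "rank_one (cnj z) x ** rank_one z x = rank_one (cnj z) x + rank_one z x" .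
  then show ?thesis
    unfolding H_def n_def[symmetric] z_def[symmetric]
    by (simp add: conj_transpose_diff conj_transpose_rank_one
        matrix_mult_diff_left matrix_mult_diff_right)
qed

text \<open>If some value \<open>q x\<close> were not real and nonnegative, a reflection changing
  the phase along \<open>x\<close> would increase the trace. So \<open>Re (q x) = |q x|\<close>
  everywhere, which yields both Hermitian symmetry and positivity.\<close>

lemma pos_semidef_if_maximizer:
  fixes T W :: "complex ^ 'n ^ 'n"
  assumes W: "conj_transpose W ** W = mat 1"
    and max: "\<And>V. conj_transpose V ** V = mat 1 \<Longrightarrow> T \<bullet> V \<le> T \<bullet> W"
  shows "pos_semidef (conj_transpose W ** T)"
proof -
  define P where "P = conj_transpose W ** T"
  define q where "q x = (\<Sum>i\<in>UNIV. cnj (x $ i) * (P *v x) $ i)" for x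
  have Re_q: "Re (q x) = cmod (q x)" for x
  proof (cases "q x = 0")
    case False
    then have x: "x \<noteq> 0"
      by (auto simp: q_def)
    then have n: "0 < x \<bullet> x" by simp
    \<comment> \<open>The phase that turns the variation \<open>Re ((1 - cnj w) q)\<close> into \<open>Re q - |q|\<close>.\<close>
    define w where "w = q x / of_real (cmod (q x))"
    have w: "cmod w = 1" and wq: "cnj w * q x = of_real (cmod (q x))"
      using False
      by (auto simp: w_def norm_divide field_simps complex_norm_square[symmetric] power2_eq_square)
    define z where "z = (1 - w) / of_real (x \<bullet> x)"
    define H where "H = mat 1 - rank_one z x"
    have H: "conj_transpose H ** H = mat 1"
      unfolding H_def z_def using complex_reflection_unitary[OF x w] .
    have "conj_transpose (W ** H) ** (W ** H) = conj_transpose H ** (conj_transpose W ** W) ** H"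
      by (simp only: conj_transpose_mult matrix_mul_assoc)
    then have "T \<bullet> (W ** H) \<le> T \<bullet> W"
      using W H by (intro max) simp
    moreover have "T \<bullet> (W ** H) = P \<bullet> H"
      by (simp add: inner_matrix_mult_left P_def)
    moreover have "T \<bullet> W = P \<bullet> mat 1"
      using inner_matrix_mult_left[of T W "mat 1"] by (simp add: P_def)
    ultimately have "0 \<le> P \<bullet> rank_one z x"
      by (simp add: H_def inner_diff_right)
    also have "\<dots> = Re (cnj z * q x)"
      by (simp add: inner_rank_one q_def)
    also have "cnj z * q x = (q x - of_real (cmod (q x))) / of_real (x \<bullet> x)"
      by (simp add: z_def wq[symmetric] field_simps)
    finally have "cmod (q x) \<le> Re (q x)"
      using n by (simp add: zero_le_divide_iff)
    then show ?thesis
      using complex_Re_le_cmod[of "q x"] by simp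
  qed simp
  have "Im (q x) = 0" "0 \<le> Re (q x)" for x
    using Re_q[of x] cmod_power2[of "q x"] by simp_all
  then show ?thesis
    unfolding pos_semidef_def P_def[symmetric]
    by (auto intro: hermitian_if_Im_quadratic_zero simp: q_def)
qed

lemma pos_semidef_sqrt_exists:
  fixes T :: "complex ^ 'n ^ 'n"
  obtains P where "pos_semidef P" and "P ** P = conj_transpose T ** T"
proof -
  obtain W where W: "conj_transpose W ** W = mat 1"
    and max: "\<And>V. conj_transpose V ** V = mat 1 \<Longrightarrow> T \<bullet> V \<le> T \<bullet> W"
    using unitary_maximizer_exists[of T] by blast
  define P where "P = conj_transpose W ** T"
  have P: "pos_semidef P"
    unfolding P_def using W max by (rule pos_semidef_if_maximizer)
  then have "P ** P = conj_transpose P ** P"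
    by (simp add: pos_semidef_iff_inner)
  also have "\<dots> = conj_transpose T ** (W ** conj_transpose W) ** T"
    by (simp add: P_def conj_transpose_mult matrix_mul_assoc)
  also have "W ** conj_transpose W = mat 1"
    using W matrix_left_right_inverse by blast
  finally show ?thesis
    using that[of P] P by simp
qed

text \<open>Existence and uniqueness together evaluate the \<open>THE\<close> in
  \<open>psd_sqrt\<close>; afterwards only products of \<open>T\<close> with its adjoint
  remain.\<close>

lemma mat_abs_square: "mat_abs T ** mat_abs T = conj_transpose T ** T"
proof -
  obtain P where P: "pos_semidef P" "P ** P = conj_transpose T ** T"
    using pos_semidef_sqrt_exists[of T] .
  then have "mat_abs T = P"
    unfolding mat_abs_def psd_sqrt_def
    by (intro the_equality) (auto intro: pos_semidef_sqrt_unique)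
  with P show ?thesis by simp
qed

section \<open>The spectral norm\<close>

lemma norm_matrix_vector_le: "norm (A *v x) \<le> op_norm A * norm x"
  unfolding op_norm_def by (rule onorm) simp

lemma op_norm_nonneg: "0 \<le> op_norm A"
  unfolding op_norm_def by (rule onorm_pos_le) simp

lemma norm_matrix_vector_square:
  "(norm (A *v x))\<^sup>2 = x \<bullet> ((conj_transpose A ** A) *v x)"
  by (simp only: power2_norm_eq_inner inner_matrix_vector[of "A *v x" A x]
      matrix_vector_mul_assoc inner_commute[of x])

text \<open>Cauchy-Schwarz bounds \<open>|A x|^2\<close>, the pairing of \<open>x\<close> with
  \<open>A^* A x\<close>, by \<open>k |x| |B x|\<close>. Both halves of the theorem and the norm of
  the adjoint are instances.\<close>

lemma op_norm_square_le:
  fixes A B :: "complex ^ 'n ^ 'n"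
  assumes "0 \<le> k" and "\<And>x. norm (conj_transpose A *v (A *v x)) \<le> k * norm (B *v x)"
  shows "(op_norm A)\<^sup>2 \<le> k * op_norm B"
proof -
  have kB: "0 \<le> k * op_norm B"
    using assms(1) op_norm_nonneg[of B] by simp
  have "norm (A *v x) \<le> sqrt (k * op_norm B) * norm x" for x
  proof (rule power2_le_imp_le)
    have "(norm (A *v x))\<^sup>2 = x \<bullet> (conj_transpose A *v (A *v x))"
      by (simp add: norm_matrix_vector_square matrix_vector_mul_assoc)
    also have "\<dots> \<le> norm x * norm (conj_transpose A *v (A *v x))"
      by (rule norm_cauchy_schwarz)
    also have "\<dots> \<le> norm x * (k * (op_norm B * norm x))"
      by (intro mult_left_mono order_trans[OF assms(2)] norm_matrix_vector_le assms(1)) auto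
    also have "\<dots> = (sqrt (k * op_norm B) * norm x)\<^sup>2"
      using kB by (simp add: power_mult_distrib power2_eq_square)
    finally show "(norm (A *v x))\<^sup>2 \<le> (sqrt (k * op_norm B) * norm x)\<^sup>2" .
  qed (use kB in simp)
  then have "op_norm A \<le> sqrt (k * op_norm B)"
    unfolding op_norm_def by (rule onorm_le)
  then show ?thesis
    using kB op_norm_nonneg real_le_rsqrt real_sqrt_le_iff
    by (metis power_mono real_sqrt_pow2)
qed

lemma op_norm_conj_transpose: "op_norm (conj_transpose A) = op_norm A"
proof -
  have le: "op_norm (conj_transpose B) \<le> op_norm B" for B :: "complex ^ 'a ^ 'a"
  proof -
    \<comment> \<open>Here the adjoint of \<open>B\<close> stands for both matrices of
      \<open>op_norm_square_le\<close>, with \<open>k\<close> the norm of \<open>B\<close>;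
      cancelling one factor gives the bound.\<close>
    have "(op_norm (conj_transpose B))\<^sup>2 \<le> op_norm B * op_norm (conj_transpose B)"
      by (rule op_norm_square_le) (simp_all add: op_norm_nonneg norm_matrix_vector_le)
    then show ?thesis
      using op_norm_nonneg[of B] op_norm_nonneg[of "conj_transpose B"]
      by (cases "op_norm (conj_transpose B) = 0") (simp_all add: power2_eq_square)
  qed
  show ?thesis
    using le[of A] le[of "conj_transpose A"] by simp
qed

text \<open>The form of \<open>A^* A\<close> at \<open>x\<close> is \<open>|A x|^2\<close>, so the
  order compares squared norms. A coefficient on each side lets one lemma serve both halves of
  normality.\<close>

lemma loewner_le_norm:
  fixes A B :: "complex ^ 'n ^ 'n"
  assumes "loewner_le (a\<^sup>2 *\<^sub>R (conj_transpose A ** A)) (b\<^sup>2 *\<^sub>R (conj_transpose B ** B))"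
    and "0 \<le> a" and "0 \<le> b"
  shows "a * norm (A *v x) \<le> b * norm (B *v x)"
proof (rule power2_le_imp_le)
  have scale: "(c *\<^sub>R M) *v x = c *\<^sub>R (M *v x)" for c and M :: "complex ^ 'n ^ 'n"
    by (simp add: matrix_vector_mult_def vec_eq_iff scaleR_right.sum)
  have "0 \<le> x \<bullet> ((b\<^sup>2 *\<^sub>R (conj_transpose B ** B) - a\<^sup>2 *\<^sub>R (conj_transpose A ** A)) *v x)"
    using assms(1) by (simp add: loewner_le_def pos_semidef_iff_inner)
  then show "(a * norm (A *v x))\<^sup>2 \<le> (b * norm (B *v x))\<^sup>2"
    by (simp add: matrix_vector_mult_diff_rdistrib scale inner_diff_right power_mult_distrib
        norm_matrix_vector_square)
qed (use assms in simp)

theorem theorem3p5: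
  fixes \<alpha> \<beta> :: real and T :: "complex ^ 'n ^ 'n"
  assumes "0 < \<alpha>" and "\<alpha> \<le> 1" and "1 \<le> \<beta>"
    and "alpha_beta_normal \<alpha> \<beta> T"
  shows "(op_norm T)\<^sup>2 \<le> (1 / \<alpha>) * op_norm (T ** T) \<and>
    (op_norm T)\<^sup>2 \<le> \<beta> * op_norm (T ** T) \<and>
    (op_norm T)\<^sup>2 \<le> min (1 / \<alpha>) \<beta> * op_norm (T ** T)"
proof -
  let ?T' = "conj_transpose T"
  have lower: "\<alpha> * norm (T *v x) \<le> norm (?T' *v x)" for x
    using loewner_le_norm[of \<alpha> T 1 ?T' x] assms by (simp add: alpha_beta_normal_def mat_abs_square)
  have upper: "norm (?T' *v x) \<le> \<beta> * norm (T *v x)" for x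
    using loewner_le_norm[of 1 ?T' \<beta> T x] assms by (simp add: alpha_beta_normal_def mat_abs_square)
  have "(op_norm ?T')\<^sup>2 \<le> (1 / \<alpha>) * op_norm (?T' ** ?T')"
    using lower assms(1)
    by (intro op_norm_square_le) (simp_all add: matrix_vector_mul_assoc[symmetric] field_simps)
  \<comment> \<open>The square of the adjoint is the adjoint of \<open>T ** T\<close>, and adjoints
    preserve the norm.\<close>
  then have 1: "(op_norm T)\<^sup>2 \<le> (1 / \<alpha>) * op_norm (T ** T)"
    by (metis conj_transpose_mult op_norm_conj_transpose)
  have 2: "(op_norm T)\<^sup>2 \<le> \<beta> * op_norm (T ** T)"
    using upper assms(3)
    by (intro op_norm_square_le) (simp_all add: matrix_vector_mul_assoc[symmetric])
  from 1 2 show ?thesis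
    by (simp add: min_def)
qed

end
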